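(* Let $\mathcal C\subset\mathbb P^2_{\mathbb C}$ be a reduced curve with irreducible components $\mathcal C_1,\dots,\mathcal C_r$ and weak combinatorial type $W_{\mathcal C}$, let $p$ be a prime and $\Bbbk=\mathbb Z/p$. Let $\alpha=\sum_i\alpha_i\sigma_i\in A^1_{W_{\mathcal C},\Bbbk}$ be non-coordinate, i.e. $\alpha_i\ne0$ for all $i$, and assume that $\mathcal C$ is completely $p$-reductive with respect to $\alpha$. Then $$H^1(A^*_{W_{\mathcal C},\Bbbk},\cdot\wedge\alpha)=0.$$
   Context: Weak combinatorial type. Let $d_i=\deg\mathcal C_i$ and $S=\mathrm{Sing}(\mathcal C)$. For $P\in S$, $\Delta_P$ is the set of irreducible local branches of $\mathcal C$ at $P$, $\phi_P:\Delta_P\to\{1,\dots,r\}$ sends a branch to the index of the component containing it, and for $\delta,\delta'\in\Delta_P$ with $\phi_P(\delta)\ne\phi_P(\delta')$, $\mu_P(\delta,\delta')$ is the local intersection number. $W=W_{\mathcal C}=(\{1,\dots,r\},S,\{\Delta_P,\phi_P,\mu_P\}_{P\in S})$. For $\delta\in\Delta_P$ and $j\ne\phi_P(\delta)$ put $\mu_P(\delta,\mathcal C_j)=\sum_{\phi_P(\delta')=j}\mu_P(\delta,\delta')$ (zero if $P\notin\mathcal C_j$). Graded algebra $A^*_{W,\Bbbk}$. $A^0=\Bbbk$; $A^1=\bigoplus_{i=1}^r\Bbbk\sigma_i$; $A^2=A^{2,0}\oplus A^{2,\infty}$; $A^i=0$ for $i\ge3$. Here $A^{2,\infty}$ is the $\Bbbk$-vector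 space on symbols $\bar\psi^i_\infty$ ($1\le i\le r$) modulo the span of those with $p\nmid d_i$, and $A^{2,0}=\bigoplus_{P\in S}(A_P\wedge A_P)/I_P$, where $A_P$ has basis $\{\psi_P^\delta\}_{\delta\in\Delta_P}$ and $I_P$ is spanned by all $\psi_P^{\delta_1}\wedge\psi_P^{\delta_2}+\psi_P^{\delta_2}\wedge\psi_P^{\delta_3}+\psi_P^{\delta_3}\wedge\psi_P^{\delta_1}$ together with, in case $\#\phi_P(\Delta_P)=1$, all $\psi_P^{\delta_1}\wedge\psi_P^{\delta_2}$. The product is bilinear and alternating on $A^1$, with, for $i\ne j$, $$\sigma_i\wedge\sigma_j=\sum_{P\in S}\ \sum_{\phi_P(\delta_1)=i,\ \phi_P(\delta_2)=j}\mu_P(\delta_1,\delta_2)\,\psi_P^{\delta_1}\wedge\psi_P^{\delta_2}+d_j\bar\psi^i_\infty-d_i\bar\psi^j_\infty .$$ For $\alpha\in A^1$, $(A^*_{W,\Bbbk},\cdot\wedge\alpha)$ is the complex $A^0\to A^1\to A^2$ given by multiplication by $\alpha$; so $H^1=\{\beta\in A^1:\beta\wedge\alpha=0\}/\Bbbk\alpha$. Complete $p$-reductivity with respect to $\alpha=\sum_i\alpha_i\sigma_i$. Start with $\pi=\mathrm{id}:\{1,\dots,r\}\to\{1,\dots,r\}$. Given a surjection $\pi:\{1,\dots,r\}\to\mathbf r'$, $\mathcal C$ is $p$-transversal at $P\in S$ w.r.t. $(\alpha,\pi)$ if $\pi(\phi_P(\Delta_P))=\{i',j'\}$ has exactly two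 elements and there is $\delta\in\Delta_P$ with $\pi(\phi_P(\delta))=i'$ such that $\sum_{\pi(j)=j'}\mu_P(\delta,\mathcal C_j)\alpha_j\ne0$ in $\Bbbk$. In that case one may replace $\pi$ by its composition with the quotient map of $\mathbf r'$ identifying $i'$ and $j'$. $\mathcal C$ is completely $p$-reductive w.r.t. $\alpha$ if some finite sequence of such steps leads to a one-element set. *)

theory Defs
  imports
    Complex_Main
    "HOL-Library.Poly_Mapping"
    "HOL-Library.Product_Plus"
    "HOL-Computational_Algebra.Squarefree"
    "HOL-Computational_Algebra.Formal_Power_Series"
    "Berlekamp_Zassenhaus.Finite_Field"
begin

section \<open>Reduced plane projective curves and their local branches\<close>

text \<open>Polynomials in three variables: the key \<open>(i, j, k)\<close> is the monomial \<open>X ^ i * Y ^ j * Z ^ k\<close>.\<close>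

type_synonym poly3 = "(nat \<times> nat \<times> nat) \<Rightarrow>\<^sub>0 complex"

definition homogeneous :: "nat \<Rightarrow> poly3 \<Rightarrow> bool" where
  "homogeneous d F \<longleftrightarrow> (\<forall>(i, j, k) \<in> Poly_Mapping.keys F. i + j + k = d)"

definition total_degree :: "poly3 \<Rightarrow> nat" where
  "total_degree F = Max ((\<lambda>(i, j, k). i + j + k) ` Poly_Mapping.keys F)"

text \<open>A reduced curve is given by its defining form, unique up to a nonzero scalar.\<close>

definition reduced_curve :: "poly3 \<Rightarrow> bool" where
  "reduced_curve F \<longleftrightarrow> (\<exists>d > 0. homogeneous d F) \<and> squarefree F"

definition has_components :: "poly3 \<Rightarrow> nat \<Rightarrow> (nat \<Rightarrow> poly3) \<Rightarrow> bool" where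
  "has_components F r G \<longleftrightarrow> (\<forall>i \<in> {1..r}. irreducible (G i)) \<and> F = (\<Prod>i = 1..r. G i)"

definition proj_rel :: "complex \<times> complex \<times> complex \<Rightarrow> complex \<times> complex \<times> complex \<Rightarrow> bool" where
  "proj_rel u v \<longleftrightarrow> u \<noteq> (0, 0, 0) \<and>
     (\<exists>c. c \<noteq> 0 \<and> v = (case u of (x, y, z) \<Rightarrow> (c * x, c * y, c * z)))"

lemma part_equivp_proj_rel: "part_equivp proj_rel"
proof (rule part_equivpI)
  have "proj_rel (1, 0, 0) (1, 0, 0)"
    unfolding proj_rel_def by (auto intro: exI[of _ 1])
  then show "\<exists>u. proj_rel u u" ..
  show "symp proj_rel"
  proof (rule sympI)
    fix u v assume "proj_rel u v"
    then obtain x y z c where u: "u = (x, y, z)" "u \<noteq> (0, 0, 0)" and c: "c \<noteq> 0"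
      and v: "v = (c * x, c * y, c * z)"
      unfolding proj_rel_def by (cases u) auto
    have "u = (inverse c * (c * x), inverse c * (c * y), inverse c * (c * z))"
      using u c by simp
    moreover have "v \<noteq> (0, 0, 0)" using u c v by auto
    ultimately show "proj_rel v u"
      unfolding proj_rel_def v using c by (auto intro!: exI[of _ "inverse c"])
  qed
  show "transp proj_rel"
  proof (rule transpI)
    fix u v w assume "proj_rel u v" "proj_rel v w"
    then obtain x y z c c' where u: "u = (x, y, z)" "u \<noteq> (0, 0, 0)" "c \<noteq> 0" "c' \<noteq> 0"
      and w: "w = (c' * (c * x), c' * (c * y), c' * (c * z))"
      unfolding proj_rel_def by (cases u) auto
    then show "proj_rel u w"
      unfolding proj_rel_def by (auto intro!: exI[of _ "c' * c"] simp: mult.assoc)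
  qed
qed

text \<open>The complex projective plane.\<close>

quotient_type proj_plane = "complex \<times> complex \<times> complex" / partial: proj_rel
  by (rule part_equivp_proj_rel)

text \<open>
  The completed local ring of the plane at a point is identified with the ring \<open>\<complex>[[s, t]]\<close>,
  realised as \<open>complex fps fps\<close>, by means of an affine chart centred at that point.
\<close>

type_synonym germ = "complex fps fps"

definition const2 :: "complex \<Rightarrow> germ" where
  "const2 c = fps_const (fps_const c)"

definition var_s :: germ where "var_s = fps_X"

definition var_t :: germ where "var_t = fps_const fps_X"

definition eval3 :: "poly3 \<Rightarrow> germ \<Rightarrow> germ \<Rightarrow> germ \<Rightarrow> germ" where
  "eval3 F x y z = (\<Sum>(i, j, k) \<in> Poly_Mapping.keys F.
     const2 (Poly_Mapping.lookup F (i, j, k)) * x ^ i * y ^ j * z ^ k)"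

lift_definition germ_at :: "poly3 \<Rightarrow> proj_plane \<Rightarrow> germ" is
  "\<lambda>F (a, b, c).
     if a \<noteq> 0 then eval3 F 1 (const2 (b / a) + var_s) (const2 (c / a) + var_t)
     else if b \<noteq> 0 then eval3 F (const2 (a / b) + var_s) 1 (const2 (c / b) + var_t)
     else eval3 F (const2 (a / c) + var_s) (const2 (b / c) + var_t) 1"
proof goal_cases
  case (1 F u v)
  then obtain a b c e where "u = (a, b, c)" "e \<noteq> 0" "v = (e * a, e * b, e * c)"
    unfolding proj_rel_def by (cases u) auto
  then show ?case by simp
qed

text \<open>Singular points: the local equation lies in the square of the maximal ideal.\<close>

definition singular_points :: "poly3 \<Rightarrow> proj_plane set" where
  "singular_points F = {P. fps_nth (fps_nth (germ_at F P) 0) 0 = 0 \<and>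
     fps_nth (fps_nth (germ_at F P) 1) 0 = 0 \<and> fps_nth (fps_nth (germ_at F P) 0) 1 = 0}"

text \<open>
  A branch is an irreducible component of the germ of the curve, represented by its (principal
  prime) ideal in the completed local ring.
\<close>

definition local_branches :: "poly3 \<Rightarrow> proj_plane \<Rightarrow> germ set set" where
  "local_branches F P = {{h. q dvd h} | q. prime_elem q \<and> q dvd germ_at F P}"

text \<open>Distinct components have no common branch, so the index chosen here is unique.\<close>

definition branch_component :: "nat \<Rightarrow> (nat \<Rightarrow> poly3) \<Rightarrow> proj_plane \<Rightarrow> germ set \<Rightarrow> nat" where
  "branch_component r G P \<delta> = (SOME i. i \<in> {1..r} \<and> germ_at (G i) P \<in> \<delta>)"

text \<open>
  The dimension over \<open>\<complex>\<close> of the quotient of the local ring by an ideal \<open>I\<close>, meaningful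
  when it is finite.
\<close>

definition colength :: "germ set \<Rightarrow> nat" where
  "colength I = (LEAST n. \<exists>B. finite B \<and> card B = n \<and>
     module.span (\<lambda>c f. const2 c * f) (B \<union> I) = UNIV)"

definition intersection_number :: "germ set \<Rightarrow> germ set \<Rightarrow> nat" where
  "intersection_number \<delta> \<delta>' = colength {f + g | f g. f \<in> \<delta> \<and> g \<in> \<delta>'}"


section \<open>Weak combinatorial types\<close>

record ('pt, 'br) weak_type =
  num_comp :: nat
  comp_deg :: "nat \<Rightarrow> nat"
  sing :: "'pt set"
  branches :: "'pt \<Rightarrow> 'br set"
  branch_comp :: "'pt \<Rightarrow> 'br \<Rightarrow> nat"
  mult :: "'pt \<Rightarrow> 'br \<Rightarrow> 'br \<Rightarrow> nat"

definition weak_type_of_curve ::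
  "poly3 \<Rightarrow> nat \<Rightarrow> (nat \<Rightarrow> poly3) \<Rightarrow> (proj_plane, germ set) weak_type" where
  "weak_type_of_curve F r G =
    \<lparr> num_comp = r,
      comp_deg = (\<lambda>i. total_degree (G i)),
      sing = singular_points F,
      branches = local_branches F,
      branch_comp = branch_component r G,
      mult = (\<lambda>P. intersection_number) \<rparr>"

definition branches_of :: "('pt, 'br) weak_type \<Rightarrow> 'pt \<Rightarrow> nat \<Rightarrow> 'br set" where
  "branches_of W P i = {\<delta> \<in> branches W P. branch_comp W P \<delta> = i}"

definition mult_comp :: "('pt, 'br) weak_type \<Rightarrow> 'pt \<Rightarrow> 'br \<Rightarrow> nat \<Rightarrow> nat" where
  "mult_comp W P \<delta> j = (\<Sum>\<delta>' \<in> branches_of W P j. mult W P \<delta> \<delta>')"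


section \<open>The graded algebra in degrees at most two\<close>

text \<open>
  The prime field is \<^typ>\<open>'p mod_ring\<close> with \<open>p = CARD('p)\<close>. An element \<open>\<Sum>i. \<beta> i \<sigma>\<^sub>i\<close> of degree one is
  the function \<open>\<beta>\<close> supported on the indices of the components.
\<close>

definition A1 :: "('pt, 'br) weak_type \<Rightarrow> (nat \<Rightarrow> 'p::prime_card mod_ring) set" where
  "A1 W = {\<beta>. \<forall>i. i \<notin> {1..num_comp W} \<longrightarrow> \<beta> i = 0}"

abbreviation scale :: "'k::comm_ring_1 \<Rightarrow> ('x \<Rightarrow>\<^sub>0 'k) \<Rightarrow> ('x \<Rightarrow>\<^sub>0 'k)" where
  "scale c \<equiv> Poly_Mapping.map (\<lambda>x. c * x)"

abbreviation basis :: "'x \<Rightarrow> ('x \<Rightarrow>\<^sub>0 'k::comm_ring_1)" where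
  "basis x \<equiv> Poly_Mapping.single x 1"

text \<open>
  The local summand at \<open>P\<close> is the quotient of the free space on pairs of branches, the pair
  \<open>(\<delta>, \<delta>')\<close> standing for the wedge of the two generators, by the span of the alternating
  relations (first two sets) and of the generators of \<open>I\<^sub>P\<close>.
\<close>

definition local_relations ::
  "('pt, 'br) weak_type \<Rightarrow> 'pt \<Rightarrow> (('br \<times> 'br) \<Rightarrow>\<^sub>0 'p::prime_card mod_ring) set" where
  "local_relations W P = module.span scale
     ({basis (\<delta>, \<delta>) | \<delta>. \<delta> \<in> branches W P}
      \<union> {basis (\<delta>, \<delta>') + basis (\<delta>', \<delta>) | \<delta> \<delta>'. \<delta> \<in> branches W P \<and> \<delta>' \<in> branches W P}
      \<union> {basis (\<delta>\<^sub>1, \<delta>\<^sub>2) + basis (\<delta>\<^sub>2, \<delta>\<^sub>3) + basis (\<delta>\<^sub>3, \<delta>\<^sub>1) | \<delta>\<^sub>1 \<delta>\<^sub>2 \<delta>\<^sub>3.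
           \<delta>\<^sub>1 \<in> branches W P \<and> \<delta>\<^sub>2 \<in> branches W P \<and> \<delta>\<^sub>3 \<in> branches W P}
      \<union> {basis (\<delta>, \<delta>') | \<delta> \<delta>'. \<delta> \<in> branches W P \<and> \<delta>' \<in> branches W P
           \<and> card (branch_comp W P ` branches W P) = 1})"

definition infinity_relations :: "('pt, 'br) weak_type \<Rightarrow> (nat \<Rightarrow>\<^sub>0 'p::prime_card mod_ring) set" where
  "infinity_relations W = module.span scale
     {basis i | i. i \<in> {1..num_comp W} \<and> \<not> CARD('p) dvd comp_deg W i}"

text \<open>
  A representative of an element of degree two is a family of local elements indexed by the
  singular points together with an element at infinity. A reduced curve has finitely many
  singular points, so there is no difference between direct sum and product.
\<close>

type_synonym ('pt, 'br, 'k) rep2 = "('pt \<Rightarrow> (('br \<times> 'br) \<Rightarrow>\<^sub>0 'k)) \<times> (nat \<Rightarrow>\<^sub>0 'k)"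

definition A2_relations :: "('pt, 'br) weak_type \<Rightarrow> ('pt, 'br, 'p::prime_card mod_ring) rep2 set" where
  "A2_relations W = {(f, g). (\<forall>P \<in> sing W. f P \<in> local_relations W P) \<and> g \<in> infinity_relations W}"

definition gen_prod_local ::
  "('pt, 'br) weak_type \<Rightarrow> nat \<Rightarrow> nat \<Rightarrow> 'pt \<Rightarrow> (('br \<times> 'br) \<Rightarrow>\<^sub>0 'p::prime_card mod_ring)" where
  "gen_prod_local W i j P = (\<Sum>\<delta>\<^sub>1 \<in> branches_of W P i. \<Sum>\<delta>\<^sub>2 \<in> branches_of W P j.
     scale (of_nat (mult W P \<delta>\<^sub>1 \<delta>\<^sub>2)) (basis (\<delta>\<^sub>1, \<delta>\<^sub>2)))"

definition gen_prod_infinity ::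
  "('pt, 'br) weak_type \<Rightarrow> nat \<Rightarrow> nat \<Rightarrow> (nat \<Rightarrow>\<^sub>0 'p::prime_card mod_ring)" where
  "gen_prod_infinity W i j =
     scale (of_nat (comp_deg W j)) (basis i) - scale (of_nat (comp_deg W i)) (basis j)"

text \<open>The bilinear extension of the products \<open>\<sigma>\<^sub>i \<and> \<sigma>\<^sub>j\<close>, where \<open>\<sigma>\<^sub>i \<and> \<sigma>\<^sub>i = 0\<close>.\<close>

definition wedge ::
  "('pt, 'br) weak_type \<Rightarrow> (nat \<Rightarrow> 'p::prime_card mod_ring) \<Rightarrow> (nat \<Rightarrow> 'p mod_ring)
     \<Rightarrow> ('pt, 'br, 'p mod_ring) rep2" where
  "wedge W \<beta> \<gamma> =
     ((\<lambda>P. \<Sum>i \<in> {1..num_comp W}. \<Sum>j \<in> {1..num_comp W} - {i}.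
         scale (\<beta> i * \<gamma> j) (gen_prod_local W i j P)),
      (\<Sum>i \<in> {1..num_comp W}. \<Sum>j \<in> {1..num_comp W} - {i}.
         scale (\<beta> i * \<gamma> j) (gen_prod_infinity W i j)))"

definition cocycles1 ::
  "('pt, 'br) weak_type \<Rightarrow> (nat \<Rightarrow> 'p::prime_card mod_ring) \<Rightarrow> (nat \<Rightarrow> 'p mod_ring) set" where
  "cocycles1 W \<alpha> = {\<beta> \<in> A1 W. wedge W \<beta> \<alpha> \<in> A2_relations W}"

definition coboundaries1 ::
  "(nat \<Rightarrow> 'p::prime_card mod_ring) \<Rightarrow> (nat \<Rightarrow> 'p mod_ring) set" where
  "coboundaries1 \<alpha> = {(\<lambda>i. c * \<alpha> i) | c. True}"

definition H1 ::
  "('pt, 'br) weak_type \<Rightarrow> (nat \<Rightarrow> 'p::prime_card mod_ring) \<Rightarrow> (nat \<Rightarrow> 'p mod_ring) set set" where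
  "H1 W \<alpha> = cocycles1 W \<alpha> //
     {(\<beta>, \<gamma>) \<in> cocycles1 W \<alpha> \<times> cocycles1 W \<alpha>. (\<lambda>i. \<beta> i - \<gamma> i) \<in> coboundaries1 \<alpha>}"


section \<open>Complete reductivity\<close>

definition transversal_at ::
  "('pt, 'br) weak_type \<Rightarrow> (nat \<Rightarrow> 'p::prime_card mod_ring) \<Rightarrow> (nat \<Rightarrow> nat) \<Rightarrow> 'pt \<Rightarrow> nat \<Rightarrow> nat \<Rightarrow> bool"
  where
  "transversal_at W \<alpha> \<pi> P i' j' \<longleftrightarrow>
     i' \<noteq> j' \<and> \<pi> ` branch_comp W P ` branches W P = {i', j'} \<and>
     (\<exists>\<delta> \<in> branches W P. \<pi> (branch_comp W P \<delta>) = i' \<and>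
        (\<Sum>j | j \<in> {1..num_comp W} \<and> \<pi> j = j'. of_nat (mult_comp W P \<delta> j) * \<alpha> j) \<noteq> 0)"

text \<open>
  The surjections reachable from the identity. The target is the image of \<open>{1..r}\<close>; the quotient
  of the target identifying \<open>i'\<close> and \<open>j'\<close> is realised by renaming \<open>j'\<close> to \<open>i'\<close>.
\<close>

inductive reachable ::
  "('pt, 'br) weak_type \<Rightarrow> (nat \<Rightarrow> 'p::prime_card mod_ring) \<Rightarrow> (nat \<Rightarrow> nat) \<Rightarrow> bool"
  for W \<alpha> where
  start: "reachable W \<alpha> id"
| step: "reachable W \<alpha> \<pi> \<Longrightarrow> P \<in> sing W \<Longrightarrow> transversal_at W \<alpha> \<pi> P i' j'
    \<Longrightarrow> reachable W \<alpha> ((\<lambda>x. if x = j' then i' else x) \<circ> \<pi>)"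

definition completely_reductive ::
  "('pt, 'br) weak_type \<Rightarrow> (nat \<Rightarrow> 'p::prime_card mod_ring) \<Rightarrow> bool" where
  "completely_reductive W \<alpha> \<longleftrightarrow> (\<exists>\<pi>. reachable W \<alpha> \<pi> \<and> is_singleton (\<pi> ` {1..num_comp W}))"

end

theory Submission
  imports Defs "HOL-Computational_Algebra.Polynomial_FPS"
begin

text \<open>
  Let \<open>\<beta>\<close> be a cocycle. Since \<open>\<alpha>\<close> is non-coordinate, one can form the ratios \<open>\<gamma> i = \<beta> i / \<alpha> i\<close>, and
  \<open>\<beta>\<close> is a multiple of \<open>\<alpha>\<close> exactly when \<open>\<gamma>\<close> is constant. Complete reductivity supplies a chain
  of partitions of the components, from the partition into points to the trivial one, and
  \<open>\<gamma>\<close> turns out to be constant on the blocks of each of them. The chain starts with nothing to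
  prove, so only the merging of two blocks \<open>i'\<close> and \<open>j'\<close> by transversality at a point \<open>P\<close> matters.

  As soon as two components pass through \<open>P\<close>, the map \<open>\<psi>\<^sub>1 \<and> \<psi>\<^sub>2 \<mapsto> \<psi>\<^sub>1 - \<psi>\<^sub>2\<close> is well defined on
  \<open>(A\<^sub>P \<and> A\<^sub>P) / I\<^sub>P\<close>, because it kills the cyclic relations. Its coefficient at a branch \<open>\<delta>\<close> on
  the component \<open>m\<close>, applied to \<open>\<beta> \<and> \<alpha>\<close>, is
  \<open>\<alpha> m * (\<Sum>j. \<mu>\<^sub>P(\<delta>, \<C>\<^sub>j) * \<alpha> j * (\<gamma> m - \<gamma> j))\<close>
  (\<open>branch_coeff_local_relation\<close>, \<open>branch_coeff_wedge\<close>). If only the blocks \<open>i'\<close> and \<open>j'\<close> meet \<open>P\<close>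
  and \<open>m\<close> lies in \<open>i'\<close>, then only the \<open>j\<close> in \<open>j'\<close> contribute, with a common factor
  \<open>\<gamma> m - \<gamma> j\<close>; what remains is the sum that transversality declares nonzero, so the two
  values of \<open>\<gamma>\<close> agree (\<open>transversal_merge\<close>).

  This argument uses only that the branches at each point are finite in number and lie on one
  of the components, and that intersection numbers are symmetric. For a plane curve, finiteness
  holds because the germ of a nonzero form is nonzero (\<open>germ_at_eq_0\<close>), hence has a finite
  order of vanishing, whereas a product of \<open>n\<close> nonunits vanishes to order at least \<open>n\<close>
  (\<open>finite_local_branches\<close>). That each branch lies on a component follows from
  multiplicativity of the germ and primality of the branch.
\<close>

section \<open>Linear algebra over finitely supported functions\<close>

lemma lookup_scale [simp]:
  "Poly_Mapping.lookup (scale c x) k = c * Poly_Mapping.lookup x k"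
  by (simp add: Poly_Mapping.map.rep_eq when_def)

lemma scale_add_right: "scale c (x + y) = scale c x + scale c y"
  by (rule poly_mapping_eqI) (simp add: lookup_add distrib_left)

lemma module_scale: "Modules.module (scale :: 'k::comm_ring_1 \<Rightarrow> ('x \<Rightarrow>\<^sub>0 'k) \<Rightarrow> _)"
  by unfold_locales (rule poly_mapping_eqI; simp only: lookup_scale lookup_add; simp add: algebra_simps)+

lemmas span_scale_sum = Modules.module.span_sum[OF module_scale]
  and span_scale_scale = Modules.module.span_scale[OF module_scale]
  and span_scale_base = Modules.module.span_base[OF module_scale]

section \<open>Coefficients of a local degree-two element along a branch\<close>

text \<open>
  The coefficient of \<open>\<psi>\<^sup>\<delta>\<close> under the map sending \<open>\<psi>\<^sub>1 \<and> \<psi>\<^sub>2\<close> to \<open>\<psi>\<^sub>1 - \<psi>\<^sub>2\<close>.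
\<close>

definition branch_coeff :: "'br set \<Rightarrow> 'br \<Rightarrow> ('br \<times> 'br \<Rightarrow>\<^sub>0 'k) \<Rightarrow> 'k::comm_ring_1" where
  "branch_coeff B \<delta> x =
     (\<Sum>\<delta>'\<in>B. Poly_Mapping.lookup x (\<delta>, \<delta>') - Poly_Mapping.lookup x (\<delta>', \<delta>))"

lemma branch_coeff_0 [simp]: "branch_coeff B \<delta> 0 = 0"
  by (simp add: branch_coeff_def)

lemma branch_coeff_add: "branch_coeff B \<delta> (x + y) = branch_coeff B \<delta> x + branch_coeff B \<delta> y"
  by (simp add: branch_coeff_def lookup_add sum.distrib sum_subtractf)

lemma branch_coeff_scale: "branch_coeff B \<delta> (scale c x) = c * branch_coeff B \<delta> x"
  by (simp add: branch_coeff_def sum_distrib_left right_diff_distrib)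

lemma branch_coeff_sum: "branch_coeff B \<delta> (\<Sum>a\<in>A. f a) = (\<Sum>a\<in>A. branch_coeff B \<delta> (f a))"
  by (induction A rule: infinite_finite_induct) (simp_all add: branch_coeff_add)

lemma branch_coeff_basis:
  assumes "finite B" "\<delta>\<^sub>1 \<in> B" "\<delta>\<^sub>2 \<in> B"
  shows "branch_coeff B \<delta> (basis (\<delta>\<^sub>1, \<delta>\<^sub>2)) = of_bool (\<delta>\<^sub>1 = \<delta>) - of_bool (\<delta>\<^sub>2 = \<delta>)"
proof -
  have "(\<Sum>\<delta>'\<in>B. Poly_Mapping.lookup (basis (\<delta>\<^sub>1, \<delta>\<^sub>2)) (\<delta>, \<delta>'))
      = (\<Sum>\<delta>'\<in>B. if \<delta>' = \<delta>\<^sub>2 then of_bool (\<delta>\<^sub>1 = \<delta>) else (0::'b))"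
    by (intro sum.cong) (auto simp: lookup_single when_def)
  moreover have "(\<Sum>\<delta>'\<in>B. Poly_Mapping.lookup (basis (\<delta>\<^sub>1, \<delta>\<^sub>2)) (\<delta>', \<delta>))
      = (\<Sum>\<delta>'\<in>B. if \<delta>' = \<delta>\<^sub>1 then of_bool (\<delta>\<^sub>2 = \<delta>) else (0::'b))"
    by (intro sum.cong) (auto simp: lookup_single when_def)
  ultimately show ?thesis
    using assms by (auto simp: branch_coeff_def sum_subtractf)
qed

text \<open>
  The coefficients of \<open>\<psi>\<^sub>1 - \<psi>\<^sub>2\<close> cancel on the alternating relations and around a triangle, so
  they descend to the quotient. The remaining generators, single wedges, occur only when all
  branches lie on one component.
\<close>

lemma branch_coeff_local_relation:
  fixes W :: "('pt, 'br) weak_type" and x :: "('br \<times> 'br) \<Rightarrow>\<^sub>0 'p::prime_card mod_ring"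
  assumes "finite (branches W P)" and "card (branch_comp W P ` branches W P) \<noteq> 1"
    and "x \<in> local_relations W P"
  shows "branch_coeff (branches W P) \<delta> x = 0"
proof -
  have "Modules.module.subspace scale {x :: _ \<Rightarrow>\<^sub>0 'p mod_ring. branch_coeff (branches W P) \<delta> x = 0}"
    by (rule Modules.module.subspaceI[OF module_scale]) (auto simp: branch_coeff_add branch_coeff_scale)
  then have "local_relations W P \<subseteq> {x :: _ \<Rightarrow>\<^sub>0 'p mod_ring. branch_coeff (branches W P) \<delta> x = 0}"
    unfolding local_relations_def
    by (rule Modules.module.span_minimal[OF module_scale, rotated])
      (use assms(1,2) in \<open>auto simp: branch_coeff_add branch_coeff_basis\<close>)
  then show ?thesis using assms(3) by blast
qed

section \<open>Cocycles of a weak combinatorial type\<close>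

text \<open>
  Antisymmetry of the product becomes usable once the two terms of each unordered pair of
  components stand together.
\<close>

lemma sum_offdiagonal_symmetric:
  fixes f :: "nat \<Rightarrow> nat \<Rightarrow> 'a::comm_monoid_add"
  assumes "finite R"
  shows "(\<Sum>i\<in>R. \<Sum>j\<in>R - {i}. f i j) = (\<Sum>i\<in>R. \<Sum>j | j \<in> R \<and> i < j. f i j + f j i)"
proof -
  have "(\<Sum>i\<in>R. \<Sum>j\<in>R - {i}. f i j)
      = (\<Sum>i\<in>R. (\<Sum>j | j \<in> R \<and> i < j. f i j) + (\<Sum>j | j \<in> R \<and> j < i. f i j))"
  proof (intro sum.cong refl)
    fix i
    have eq: "R - {i} = {j. j \<in> R \<and> i < j} \<union> {j. j \<in> R \<and> j < i}" by auto
    show "(\<Sum>j\<in>R - {i}. f i j) = (\<Sum>j | j \<in> R \<and> i < j. f i j) + (\<Sum>j | j \<in> R \<and> j < i. f i j)"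
      unfolding eq using assms by (intro sum.union_disjoint) auto
  qed
  moreover have "(\<Sum>i\<in>R. \<Sum>j | j \<in> R \<and> j < i. f i j) = (\<Sum>i\<in>R. \<Sum>j | j \<in> R \<and> i < j. f j i)"
    using sum.swap_restrict[OF assms assms, of f "\<lambda>i j. j < i"] .
  ultimately show ?thesis by (simp only: sum.distrib)
qed

text \<open>
  The properties of the weak combinatorial type of a curve on which the vanishing rests.
\<close>

locale finite_weak_type =
  fixes W :: "('pt, 'br) weak_type"
  assumes finite_branches: "finite (branches W P)"
    and branch_comp_range: "\<delta> \<in> branches W P \<Longrightarrow> branch_comp W P \<delta> \<in> {1..num_comp W}"
    and mult_commute: "mult W P \<delta> \<delta>' = mult W P \<delta>' \<delta>"
begin

lemma branches_of_subset: "branches_of W P i \<subseteq> branches W P"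
  by (auto simp: branches_of_def)

lemma finite_branches_of: "finite (branches_of W P i)"
  using finite_branches branches_of_subset by (rule finite_subset[rotated])

text \<open>
  For \<open>i \<noteq> j\<close>, the branches of \<open>\<C>\<^sub>i\<close> enter \<open>\<sigma>\<^sub>i \<and> \<sigma>\<^sub>j\<close> on the left and those of \<open>\<C>\<^sub>j\<close> on the right, so \<open>\<delta>\<close>
  on one of the two curves meets the other with its full local intersection number. For \<open>i = j\<close>
  the two terms cancel.
\<close>

lemma branch_coeff_gen_prod_local:
  fixes \<delta> P
  assumes "\<delta> \<in> branches W P"
  defines "m \<equiv> branch_comp W P \<delta>"
  shows "branch_coeff (branches W P) \<delta> (gen_prod_local W i j P :: _ \<Rightarrow>\<^sub>0 'p::prime_card mod_ring)
    = of_bool (i = m) * of_nat (mult_comp W P \<delta> j)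
      - of_bool (j = m) * of_nat (mult_comp W P \<delta> i)"
proof -
  have mem: "\<delta>' \<in> branches_of W P i \<Longrightarrow> \<delta>' \<in> branches W P" for i \<delta>'
    using branches_of_subset by blast
  have \<delta>_of: "\<delta> \<in> branches_of W P i \<longleftrightarrow> i = m" for i
    using assms by (auto simp: branches_of_def)
  have "branch_coeff (branches W P) \<delta> (gen_prod_local W i j P :: _ \<Rightarrow>\<^sub>0 'p mod_ring)
    = (\<Sum>\<delta>\<^sub>1\<in>branches_of W P i. \<Sum>\<delta>\<^sub>2\<in>branches_of W P j.
        of_nat (mult W P \<delta>\<^sub>1 \<delta>\<^sub>2) * (of_bool (\<delta>\<^sub>1 = \<delta>) - of_bool (\<delta>\<^sub>2 = \<delta>)))"
    unfolding gen_prod_local_def branch_coeff_sum branch_coeff_scale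
    by (intro sum.cong refl) (simp add: branch_coeff_basis finite_branches mem)
  also have "\<dots> = (\<Sum>\<delta>\<^sub>1\<in>branches_of W P i. if \<delta>\<^sub>1 = \<delta> then
                    \<Sum>\<delta>\<^sub>2\<in>branches_of W P j. of_nat (mult W P \<delta> \<delta>\<^sub>2) else 0)
      - (\<Sum>\<delta>\<^sub>2\<in>branches_of W P j. if \<delta>\<^sub>2 = \<delta> then
                    \<Sum>\<delta>\<^sub>1\<in>branches_of W P i. of_nat (mult W P \<delta> \<delta>\<^sub>1) else 0)"
    (is "_ = ?A - ?B")
  proof -
    have "(\<Sum>\<delta>\<^sub>1\<in>branches_of W P i. \<Sum>\<delta>\<^sub>2\<in>branches_of W P j.
              of_nat (mult W P \<delta>\<^sub>1 \<delta>\<^sub>2) * of_bool (\<delta>\<^sub>1 = \<delta>) :: 'p mod_ring) = ?A"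
      by (intro sum.cong) auto
    moreover have "(\<Sum>\<delta>\<^sub>1\<in>branches_of W P i. \<Sum>\<delta>\<^sub>2\<in>branches_of W P j.
              of_nat (mult W P \<delta>\<^sub>1 \<delta>\<^sub>2) * of_bool (\<delta>\<^sub>2 = \<delta>) :: 'p mod_ring) = ?B"
      by (subst sum.swap) (intro sum.cong, auto simp: mult_commute)
    ultimately show ?thesis
      by (simp add: right_diff_distrib sum_subtractf)
  qed
  also have "\<dots> = of_bool (i = m) * of_nat (mult_comp W P \<delta> j)
      - of_bool (j = m) * of_nat (mult_comp W P \<delta> i)"
    by (simp add: finite_branches_of \<delta>_of mult_comp_def)
  finally show ?thesis .
qed

text \<open>
  Among the products \<open>\<sigma>\<^sub>i \<and> \<sigma>\<^sub>j\<close> only those involving the component of \<open>\<delta>\<close> survive. The summand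
  for this component itself vanishes, which lets the sum run over all of them.
\<close>

lemma branch_coeff_wedge:
  fixes \<delta> P and \<beta> \<alpha> :: "nat \<Rightarrow> 'p::prime_card mod_ring"
  assumes "\<delta> \<in> branches W P"
  defines "m \<equiv> branch_comp W P \<delta>"
  shows "branch_coeff (branches W P) \<delta> (fst (wedge W \<beta> \<alpha>) P)
    = (\<Sum>j\<in>{1..num_comp W}. of_nat (mult_comp W P \<delta> j) * (\<beta> m * \<alpha> j - \<beta> j * \<alpha> m))"
proof -
  let ?R = "{1..num_comp W}" and ?M = "\<lambda>j. of_nat (mult_comp W P \<delta> j) :: 'p mod_ring"
  have m: "m \<in> ?R" using branch_comp_range assms by simp
  have "branch_coeff (branches W P) \<delta> (fst (wedge W \<beta> \<alpha>) P)
    = (\<Sum>i\<in>?R. \<Sum>j\<in>?R - {i}.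
        \<beta> i * \<alpha> j * (of_bool (i = m) * ?M j - of_bool (j = m) * ?M i))"
    unfolding wedge_def fst_conv branch_coeff_sum branch_coeff_scale
    by (simp add: branch_coeff_gen_prod_local assms(1) m_def)
  also have "\<dots> = (\<Sum>i\<in>?R. \<Sum>j\<in>?R.
        \<beta> i * \<alpha> j * (of_bool (i = m) * ?M j - of_bool (j = m) * ?M i))"
    by (intro sum.cong refl sum.mono_neutral_left) auto
  also have "\<dots> = (\<Sum>i\<in>?R. if i = m then \<Sum>j\<in>?R. \<beta> m * \<alpha> j * ?M j else 0)
      - (\<Sum>j\<in>?R. if j = m then \<Sum>i\<in>?R. \<beta> i * \<alpha> m * ?M i else 0)" (is "_ = ?A - ?B")
  proof -
    have "(\<Sum>i\<in>?R. \<Sum>j\<in>?R. \<beta> i * \<alpha> j * (of_bool (i = m) * ?M j)) = ?A"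
      by (intro sum.cong) auto
    moreover have "(\<Sum>i\<in>?R. \<Sum>j\<in>?R. \<beta> i * \<alpha> j * (of_bool (j = m) * ?M i)) = ?B"
      by (subst sum.swap) (intro sum.cong, auto)
    ultimately show ?thesis
      by (simp add: right_diff_distrib sum_subtractf)
  qed
  also have "\<dots> = (\<Sum>j\<in>?R. ?M j * (\<beta> m * \<alpha> j - \<beta> j * \<alpha> m))"
    using m by (simp add: algebra_simps sum_subtractf)
  finally show ?thesis .
qed

text \<open>
  The decisive step: transversality at \<open>P\<close> forces the common ratio on the block \<open>i'\<close> to equal
  the one on the block \<open>j'\<close>. The hypothesis \<open>const\<close> is the induction hypothesis that each
  block has a common ratio.
\<close>

lemma transversal_merge:
  fixes \<alpha> \<beta> :: "nat \<Rightarrow> 'p::prime_card mod_ring"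
  assumes cocycle: "\<beta> \<in> cocycles1 W \<alpha>"
    and nz: "\<And>i. i \<in> {1..num_comp W} \<Longrightarrow> \<alpha> i \<noteq> 0"
    and const: "\<And>i j. \<lbrakk>i \<in> {1..num_comp W}; j \<in> {1..num_comp W}; \<pi> i = \<pi> j\<rbrakk>
        \<Longrightarrow> \<beta> i / \<alpha> i = \<beta> j / \<alpha> j"
    and P: "P \<in> sing W" "transversal_at W \<alpha> \<pi> P i' j'"
    and i: "i \<in> {1..num_comp W}" "\<pi> i = i'" and j: "j \<in> {1..num_comp W}" "\<pi> j = j'"
  shows "\<beta> i / \<alpha> i = \<beta> j / \<alpha> j"
proof -
  let ?R = "{1..num_comp W}" and ?B = "branches W P"
  define \<gamma> where "\<gamma> k = \<beta> k / \<alpha> k" for k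
  from P(2) obtain \<delta> where ne: "i' \<noteq> j'" and im: "\<pi> ` branch_comp W P ` ?B = {i', j'}"
    and \<delta>: "\<delta> \<in> ?B" "\<pi> (branch_comp W P \<delta>) = i'"
    and tr: "(\<Sum>k | k \<in> ?R \<and> \<pi> k = j'. of_nat (mult_comp W P \<delta> k) * \<alpha> k) \<noteq> 0"
    unfolding transversal_at_def by blast
  let ?M = "\<lambda>k. of_nat (mult_comp W P \<delta> k) :: 'p mod_ring"
  define m where "m = branch_comp W P \<delta>"
  have m: "m \<in> ?R" "\<pi> m = i'" using branch_comp_range \<delta> by (auto simp: m_def)
  have \<beta>: "\<beta> k = \<gamma> k * \<alpha> k" if "k \<in> ?R" for k using nz[OF that] by (simp add: \<gamma>_def)
  have \<gamma>: "\<gamma> k = \<gamma> l" if "k \<in> ?R" "l \<in> ?R" "\<pi> k = \<pi> l" for k l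
    using const[OF that] by (simp add: \<gamma>_def)
  \<comment> \<open>Two blocks meet at \<open>P\<close>, so two components do, and the relations killing all wedges are absent.\<close>
  have "card (branch_comp W P ` ?B) \<noteq> 1"
  proof
    assume "card (branch_comp W P ` ?B) = 1"
    then obtain k where "branch_comp W P ` ?B = {k}" by (rule card_1_singletonE)
    then show False using im ne by (auto simp: doubleton_eq_iff)
  qed
  moreover have "fst (wedge W \<beta> \<alpha>) P \<in> local_relations W P"
    using cocycle P(1) by (auto simp: cocycles1_def A2_relations_def split: prod.splits)
  ultimately have "branch_coeff ?B \<delta> (fst (wedge W \<beta> \<alpha>) P) = 0"
    using finite_branches by (intro branch_coeff_local_relation)
  then have "0 = (\<Sum>k\<in>?R. ?M k * (\<beta> m * \<alpha> k - \<beta> k * \<alpha> m))"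
    unfolding m_def branch_coeff_wedge[OF \<delta>(1)] by (rule sym)
  \<comment> \<open>Components in the block of \<open>m\<close> have the ratio of \<open>m\<close>; those in a third block miss \<open>P\<close>.\<close>
  also have "\<dots> = (\<Sum>k | k \<in> ?R \<and> \<pi> k = j'. ?M k * (\<beta> m * \<alpha> k - \<beta> k * \<alpha> m))"
  proof (intro sum.mono_neutral_right ballI)
    fix k assume "k \<in> ?R - {k \<in> ?R. \<pi> k = j'}"
    then have k: "k \<in> ?R" "\<pi> k \<noteq> j'" by auto
    show "?M k * (\<beta> m * \<alpha> k - \<beta> k * \<alpha> m) = 0"
    proof (cases "\<pi> k = i'")
      case True
      then have "\<gamma> k = \<gamma> m" using \<gamma>[of k m] k m by simp
      then show ?thesis using \<beta>[of k] \<beta>[of m] k m by simp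
    next
      case False
      then have "branches_of W P k = {}" using im k by (auto simp: branches_of_def)
      then show ?thesis by (simp add: mult_comp_def)
    qed
  qed auto
  also have "\<dots> = (\<Sum>k | k \<in> ?R \<and> \<pi> k = j'. \<alpha> m * (\<gamma> i - \<gamma> j) * (?M k * \<alpha> k))"
  proof (intro sum.cong refl)
    fix k assume "k \<in> {k. k \<in> ?R \<and> \<pi> k = j'}"
    then have "\<beta> k = \<gamma> j * \<alpha> k" "\<beta> m = \<gamma> i * \<alpha> m"
      using \<beta>[of k] \<beta>[of m] \<gamma>[of k j] \<gamma>[of m i] i j m by auto
    then show "?M k * (\<beta> m * \<alpha> k - \<beta> k * \<alpha> m) = \<alpha> m * (\<gamma> i - \<gamma> j) * (?M k * \<alpha> k)"
      by (simp add: algebra_simps)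
  qed
  finally have "\<alpha> m * (\<gamma> i - \<gamma> j) * (\<Sum>k | k \<in> ?R \<and> \<pi> k = j'. ?M k * \<alpha> k) = 0"
    by (simp add: sum_distrib_left)
  then show ?thesis using tr nz m by (auto simp: \<gamma>_def)
qed

text \<open>
  Two components newly identified by a step lie in the two merged blocks, where
  \<open>transversal_merge\<close> applies; all others were identified before.
\<close>

lemma cocycle_ratio_constant_on_fibres:
  fixes \<alpha> \<beta> :: "nat \<Rightarrow> 'p::prime_card mod_ring"
  assumes "reachable W \<alpha> \<pi>" and cocycle: "\<beta> \<in> cocycles1 W \<alpha>"
    and nz: "\<And>i. i \<in> {1..num_comp W} \<Longrightarrow> \<alpha> i \<noteq> 0"
  shows "\<lbrakk>i \<in> {1..num_comp W}; j \<in> {1..num_comp W}; \<pi> i = \<pi> j\<rbrakk>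
    \<Longrightarrow> \<beta> i / \<alpha> i = \<beta> j / \<alpha> j"
  using assms(1)
proof (induction arbitrary: i j rule: reachable.induct)
  case start
  then have "i = j" by simp
  then show ?case by simp
next
  case (step \<pi> P i' j')
  note merge = transversal_merge[OF cocycle nz step.IH step.hyps(2,3)]
  from step.prems(3) consider "\<pi> i = \<pi> j" | "\<pi> i = i'" "\<pi> j = j'" | "\<pi> i = j'" "\<pi> j = i'"
    by (auto split: if_splits)
  then show ?case
  proof cases
    case 1
    then show ?thesis using step.IH step.prems(1,2) by blast
  next
    case 2 with step.prems show ?thesis by (intro merge)
  next
    case 3 with step.prems show ?thesis by (intro merge[symmetric])
  qed
qed

lemma cocycles1_subset_coboundaries1:
  fixes \<alpha> :: "nat \<Rightarrow> 'p::prime_card mod_ring"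
  assumes "\<alpha> \<in> A1 W" and nz: "\<And>i. i \<in> {1..num_comp W} \<Longrightarrow> \<alpha> i \<noteq> 0"
    and "completely_reductive W \<alpha>"
  shows "cocycles1 W \<alpha> \<subseteq> coboundaries1 \<alpha>"
proof
  fix \<beta> assume \<beta>: "\<beta> \<in> cocycles1 W \<alpha>"
  obtain \<pi> c where \<pi>: "reachable W \<alpha> \<pi>" "\<pi> ` {1..num_comp W} = {c}"
    using assms(3) by (auto simp: completely_reductive_def is_singleton_def)
  then obtain i where i: "i \<in> {1..num_comp W}" by blast
  have "\<beta> j = \<beta> i / \<alpha> i * \<alpha> j" for j
  proof (cases "j \<in> {1..num_comp W}")
    case True
    then have "\<pi> i = \<pi> j" using i \<pi>(2) by (metis imageI singletonD)
    then have "\<beta> i / \<alpha> i = \<beta> j / \<alpha> j"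
      using cocycle_ratio_constant_on_fibres[OF \<pi>(1) \<beta> nz] i True by blast
    then show ?thesis using nz[OF True] by simp
  next
    case False
    then show ?thesis using \<beta> assms(1) by (auto simp: cocycles1_def A1_def)
  qed
  then show "\<beta> \<in> coboundaries1 \<alpha>" unfolding coboundaries1_def by blast
qed

lemma gen_prod_local_antisym:
  "gen_prod_local W i j P + gen_prod_local W j i P
    \<in> (local_relations W P :: (_ \<Rightarrow>\<^sub>0 'p::prime_card mod_ring) set)"
proof -
  have "gen_prod_local W i j P + gen_prod_local W j i P
    = (\<Sum>\<delta>\<^sub>1\<in>branches_of W P i. \<Sum>\<delta>\<^sub>2\<in>branches_of W P j.
        scale (of_nat (mult W P \<delta>\<^sub>1 \<delta>\<^sub>2)) (basis (\<delta>\<^sub>1, \<delta>\<^sub>2) + basis (\<delta>\<^sub>2, \<delta>\<^sub>1)) :: _ \<Rightarrow>\<^sub>0 'p mod_ring)"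
    unfolding gen_prod_local_def
    by (subst (2) sum.swap) (simp add: scale_add_right sum.distrib mult_commute)
  also have "\<dots> \<in> local_relations W P"
    unfolding local_relations_def
    by (intro span_scale_sum span_scale_scale span_scale_base) (auto simp: branches_of_def)
  finally show ?thesis .
qed

text \<open>
  The product \<open>\<alpha> \<and> \<alpha>\<close> vanishes: in the local summands modulo the alternating relations, and at
  infinity already on representatives.
\<close>

lemma coboundaries1_subset_cocycles1:
  fixes \<alpha> :: "nat \<Rightarrow> 'p::prime_card mod_ring"
  assumes "\<alpha> \<in> A1 W"
  shows "coboundaries1 \<alpha> \<subseteq> cocycles1 W \<alpha>"
proof
  fix \<beta> assume "\<beta> \<in> coboundaries1 \<alpha>"
  then obtain c where \<beta>: "\<beta> = (\<lambda>i. c * \<alpha> i)" by (auto simp: coboundaries1_def)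
  let ?R = "{1..num_comp W}"
  have "fst (wedge W \<beta> \<alpha>) P \<in> local_relations W P" for P
  proof -
    have "scale (c * \<alpha> i * \<alpha> j) (gen_prod_local W i j P) + scale (c * \<alpha> j * \<alpha> i) (gen_prod_local W j i P)
        = scale (c * \<alpha> i * \<alpha> j) (gen_prod_local W i j P + gen_prod_local W j i P)" for i j
      by (rule poly_mapping_eqI) (simp only: lookup_scale lookup_add, simp add: algebra_simps)
    then have "fst (wedge W \<beta> \<alpha>) P = (\<Sum>i\<in>?R. \<Sum>j | j \<in> ?R \<and> i < j.
        scale (c * \<alpha> i * \<alpha> j) (gen_prod_local W i j P + gen_prod_local W j i P))"
      unfolding wedge_def \<beta> fst_conv
      by (subst sum_offdiagonal_symmetric) (simp_all only: finite_atLeastAtMost)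
    also have "\<dots> \<in> local_relations W P"
      unfolding local_relations_def
      by (intro span_scale_sum span_scale_scale gen_prod_local_antisym[unfolded local_relations_def])
    finally show ?thesis .
  qed
  moreover have "snd (wedge W \<beta> \<alpha>) = 0"
  proof -
    have "scale (c * \<alpha> i * \<alpha> j) (gen_prod_infinity W i j)
        + scale (c * \<alpha> j * \<alpha> i) (gen_prod_infinity W j i) = 0" for i j
      by (rule poly_mapping_eqI)
        (simp only: gen_prod_infinity_def lookup_scale lookup_add lookup_minus, simp add: algebra_simps)
    then show ?thesis
      unfolding wedge_def \<beta> snd_conv
      by (subst sum_offdiagonal_symmetric) simp_all
  qed
  moreover have "0 \<in> (infinity_relations W :: (_ \<Rightarrow>\<^sub>0 'p mod_ring) set)"
    unfolding infinity_relations_def by (rule Modules.module.span_zero[OF module_scale])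
  moreover have "\<beta> \<in> A1 W" using assms by (auto simp: \<beta> A1_def)
  ultimately show "\<beta> \<in> cocycles1 W \<alpha>"
    by (cases "wedge W \<beta> \<alpha>") (simp add: cocycles1_def A2_relations_def)
qed

theorem H1_eq_coboundaries1:
  fixes \<alpha> :: "nat \<Rightarrow> 'p::prime_card mod_ring"
  assumes "\<alpha> \<in> A1 W" and "\<And>i. i \<in> {1..num_comp W} \<Longrightarrow> \<alpha> i \<noteq> 0"
    and "completely_reductive W \<alpha>"
  shows "H1 W \<alpha> = {coboundaries1 \<alpha>}"
proof -
  have eq: "cocycles1 W \<alpha> = coboundaries1 \<alpha>"
    by (intro equalityI cocycles1_subset_coboundaries1 coboundaries1_subset_cocycles1 assms)
  have diff: "(\<lambda>i. \<beta> i - \<gamma> i) \<in> coboundaries1 \<alpha>"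
    if "\<beta> \<in> coboundaries1 \<alpha>" "\<gamma> \<in> coboundaries1 \<alpha>" for \<beta> \<gamma>
  proof -
    from that obtain b c where "\<beta> = (\<lambda>i. b * \<alpha> i)" "\<gamma> = (\<lambda>i. c * \<alpha> i)"
      by (auto simp: coboundaries1_def)
    then have "(\<lambda>i. \<beta> i - \<gamma> i) = (\<lambda>i. (b - c) * \<alpha> i)" by (simp add: left_diff_distrib)
    then show ?thesis unfolding coboundaries1_def by blast
  qed
  define R where "R = {(\<beta>, \<gamma>) \<in> coboundaries1 \<alpha> \<times> coboundaries1 \<alpha>.
    (\<lambda>i. \<beta> i - \<gamma> i) \<in> coboundaries1 \<alpha>}"
  have "R `` {\<beta>} = coboundaries1 \<alpha>" if "\<beta> \<in> coboundaries1 \<alpha>" for \<beta>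
    using diff that by (auto simp: R_def)
  moreover have "(\<lambda>i. 0 * \<alpha> i) \<in> coboundaries1 \<alpha>" unfolding coboundaries1_def by blast
  ultimately have "coboundaries1 \<alpha> // R = {coboundaries1 \<alpha>}"
    unfolding quotient_def by blast
  then show ?thesis unfolding H1_def eq R_def .
qed

end

section \<open>Germs of a form\<close>

definition monomial3 :: "germ \<Rightarrow> germ \<Rightarrow> germ \<Rightarrow> nat \<times> nat \<times> nat \<Rightarrow> germ" where
  "monomial3 x y z = (\<lambda>(i, j, k). x ^ i * y ^ j * z ^ k)"

lemma monomial3_add: "monomial3 x y z (a + b) = monomial3 x y z a * monomial3 x y z b"
  by (cases a; cases b) (simp add: monomial3_def power_add algebra_simps)

lemma const2_0 [simp]: "const2 0 = 0" and const2_1 [simp]: "const2 1 = 1"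
  and const2_add: "const2 (a + b) = const2 a + const2 b"
  and const2_mult: "const2 (a * b) = const2 a * const2 b"
  by (simp_all add: const2_def)

lemma fps_const_sum: "fps_const (\<Sum>i\<in>A. f i) = (\<Sum>i\<in>A. fps_const (f i))"
  by (induction A rule: infinite_finite_induct) (simp_all flip: fps_const_add)

lemma eval3_superset:
  assumes "finite A" "Poly_Mapping.keys F \<subseteq> A"
  shows "eval3 F x y z = (\<Sum>m\<in>A. const2 (Poly_Mapping.lookup F m) * monomial3 x y z m)"
proof -
  have "eval3 F x y z
      = (\<Sum>m\<in>Poly_Mapping.keys F. const2 (Poly_Mapping.lookup F m) * monomial3 x y z m)"
    unfolding eval3_def monomial3_def by (intro sum.cong) (auto simp: mult.assoc)
  also have "\<dots> = (\<Sum>m\<in>A. const2 (Poly_Mapping.lookup F m) * monomial3 x y z m)"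
    using assms by (intro sum.mono_neutral_left) (auto simp: in_keys_iff)
  finally show ?thesis .
qed

lemma eval3_0 [simp]: "eval3 0 x y z = 0"
  by (simp add: eval3_def)

lemma eval3_add: "eval3 (F + H) x y z = eval3 F x y z + eval3 H x y z"
proof -
  let ?A = "Poly_Mapping.keys F \<union> Poly_Mapping.keys H"
  have "finite ?A" by simp
  moreover have "Poly_Mapping.keys (F + H) \<subseteq> ?A" by (rule Poly_Mapping.keys_add)
  ultimately show ?thesis
    by (simp add: eval3_superset[of ?A] lookup_add const2_add algebra_simps sum.distrib)
qed

lemma eval3_single: "eval3 (Poly_Mapping.single m c) x y z = const2 c * monomial3 x y z m"
  by (subst eval3_superset[of "{m}"]) auto

lemma eval3_single_mult:
  "eval3 (Poly_Mapping.single m c * H) x y z = const2 c * monomial3 x y z m * eval3 H x y z"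
proof (induction H rule: update_induct)
  case const
  then show ?case by simp
next
  case (update H a b)
  have eq: "Poly_Mapping.update a b H = Poly_Mapping.single a b + H"
    using update.hyps(1) by (intro poly_mapping_eqI)
      (auto simp: Poly_Mapping.lookup_update lookup_add lookup_single when_def in_keys_iff)
  show ?case
    unfolding eq distrib_left eval3_add mult_single eval3_single update.IH monomial3_add const2_mult
    by (simp only: mult_ac)
qed

lemma eval3_mult: "eval3 (F * H) x y z = eval3 F x y z * eval3 H x y z"
proof (induction F rule: update_induct)
  case const
  then show ?case by simp
next
  case (update F a b)
  have "Poly_Mapping.update a b F = Poly_Mapping.single a b + F"
    using update.hyps(1) by (intro poly_mapping_eqI)
      (auto simp: Poly_Mapping.lookup_update lookup_add lookup_single when_def in_keys_iff)
  then show ?case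
    by (simp add: distrib_right eval3_add eval3_single_mult eval3_single update.IH)
qed

lemma eval3_1: "eval3 1 x y z = 1"
  using eval3_single[of 0 1 x y z] by (simp add: monomial3_def case_prod_unfold)

text \<open>
  Taking germs is evaluation at one triple of power series that depends on the point alone, so
  it inherits the multiplicativity of evaluation.
\<close>

lemma germ_at_as_eval3:
  fixes P :: proj_plane
  obtains b e where "\<And>F. germ_at F P = eval3 F 1 (const2 b + var_s) (const2 e + var_t)"
  | b e where "\<And>F. germ_at F P = eval3 F (const2 b + var_s) 1 (const2 e + var_t)"
  | b e where "\<And>F. germ_at F P = eval3 F (const2 b + var_s) (const2 e + var_t) 1"
proof (induction P rule: proj_plane.abs_induct)
  case (1 u)
  obtain a b c where u: "u = (a, b, c)" by (cases u)
  have "germ_at F (abs_proj_plane u) = (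
     if a \<noteq> 0 then eval3 F 1 (const2 (b / a) + var_s) (const2 (c / a) + var_t)
     else if b \<noteq> 0 then eval3 F (const2 (a / b) + var_s) 1 (const2 (c / b) + var_t)
     else eval3 F (const2 (a / c) + var_s) (const2 (b / c) + var_t) 1)" for F
    using germ_at.abs_eq[OF 1(1)] by (simp add: u)
  then show thesis
    using "1.prems"(1)[of "b / a" "c / a"] "1.prems"(2)[of "a / b" "c / b"]
      "1.prems"(3)[of "a / c" "b / c"]
    by (cases "a = 0"; cases "b = 0") simp_all
qed

lemma germ_at_mult: "germ_at (F * H) P = germ_at F P * germ_at H P"
  by (rule germ_at_as_eval3[of P]) (simp_all add: eval3_mult)

lemma germ_at_1: "germ_at 1 P = 1"
  by (rule germ_at_as_eval3[of P]) (simp_all add: eval3_1)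

lemma germ_at_prod: "germ_at (\<Prod>i\<in>A. G i) P = (\<Prod>i\<in>A. germ_at (G i) P)"
  by (induction A rule: infinite_finite_induct) (simp_all add: germ_at_mult germ_at_1)

lemma pcompose_monom: "pcompose (monom c n) q = smult c (q ^ n)"
  by (induction n) (simp_all add: monom_0 monom_Suc pcompose_pCons)

text \<open>
  The sum is the image of the polynomial with coefficients \<open>c\<close> under the translation
  \<open>X \<mapsto> b + X\<close>, and translation is injective on polynomials.
\<close>

lemma shifted_variable_powers_independent:
  fixes c :: "nat \<Rightarrow> 'a::idom"
  assumes "(\<Sum>i\<le>N. fps_const (c i) * (fps_const b + fps_X) ^ i) = 0" and "i \<le> N"
  shows "c i = 0"
proof -
  define p where "p = (\<Sum>i\<le>N. monom (c i) i)"
  have "fps_of_poly (pcompose p [:b, 1:]) = (\<Sum>i\<le>N. fps_const (c i) * (fps_const b + fps_X) ^ i)"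
    by (simp add: p_def pcompose_sum pcompose_monom fps_of_poly_sum fps_of_poly_mult
        fps_of_poly_power fps_of_poly_smult fps_of_poly_pCons mult.commute add.commute)
  then have "fps_of_poly (pcompose p [:b, 1:]) = fps_of_poly 0" using assms(1) by simp
  then have "p = 0" by (simp only: fps_of_poly_eq_iff) (rule pcompose_eq_0, auto)
  then have "coeff p i = 0" by simp
  then show ?thesis using assms(2) by (simp add: p_def coeff_sum)
qed

text \<open>
  Two applications of the one-variable case, first with coefficients in power series in \<open>t\<close>.
  Indexing by an arbitrary finite set \<open>K\<close> allows the same result to serve all three
  affine charts.
\<close>

lemma shifted_monomials_independent:
  assumes "finite K" and inj: "inj_on h K"
    and "(\<Sum>m\<in>K. const2 (f m) * (const2 b + var_s) ^ fst (h m) * (const2 e + var_t) ^ snd (h m)) = 0"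
    and "m \<in> K"
  shows "f m = 0"
proof -
  obtain N where "\<forall>n\<in>fst ` h ` K \<union> snd ` h ` K. n \<le> N"
    using assms(1) by (meson finite_UnI finite_imageI finite_nat_set_iff_bounded_le)
  then have N: "fst (h m) \<le> N" "snd (h m) \<le> N" if "m \<in> K" for m
    using that by auto
  \<comment> \<open>The family is spread over a square of exponents, with zeros outside the image of \<open>h\<close>.\<close>
  define c where "c i j = (if (i, j) \<in> h ` K then f (inv_into K h (i, j)) else 0)" for i j
  define row where "row i = (\<Sum>j\<le>N. fps_const (c i j) * (fps_const e + fps_X) ^ j)" for i
  let ?s = "const2 b + var_s" and ?t = "const2 e + var_t"
  have "0 = (\<Sum>(i, j)\<in>h ` K. const2 (c i j) * ?s ^ i * ?t ^ j)"
    using assms(3) inj by (simp add: sum.reindex c_def case_prod_unfold)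
  also have "\<dots> = (\<Sum>(i, j)\<in>{..N} \<times> {..N}. const2 (c i j) * ?s ^ i * ?t ^ j)"
  proof (rule sum.mono_neutral_left)
    show "h ` K \<subseteq> {..N} \<times> {..N}" using N by (simp add: image_subset_iff mem_Times_iff)
    have "c i j = 0" if "(i, j) \<notin> h ` K" for i j
      using that by (simp add: c_def)
    then show "\<forall>x\<in>{..N} \<times> {..N} - h ` K. (case x of (i, j) \<Rightarrow> const2 (c i j) * ?s ^ i * ?t ^ j) = 0"
      by (clarify, simp)
  qed simp
  also have "\<dots> = (\<Sum>i\<le>N. \<Sum>j\<le>N. const2 (c i j) * ?s ^ i * ?t ^ j)"
    by (rule sum.cartesian_product[symmetric])
  also have "\<dots> = (\<Sum>i\<le>N. \<Sum>j\<le>N. fps_const (fps_const (c i j) * (fps_const e + fps_X) ^ j)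
                    * (fps_const (fps_const b) + fps_X) ^ i)"
  proof (intro sum.cong refl)
    fix i j
    have "?t = fps_const (fps_const e + fps_X)" by (simp add: const2_def var_t_def)
    then have "const2 (c i j) * ?t ^ j = fps_const (fps_const (c i j) * (fps_const e + fps_X) ^ j)"
      by (simp add: const2_def)
    moreover have "const2 (c i j) * ?s ^ i * ?t ^ j = const2 (c i j) * ?t ^ j * ?s ^ i"
      by (simp only: mult_ac)
    ultimately show "const2 (c i j) * ?s ^ i * ?t ^ j =
        fps_const (fps_const (c i j) * (fps_const e + fps_X) ^ j) * (fps_const (fps_const b) + fps_X) ^ i"
      by (simp add: const2_def[of b] var_s_def)
  qed
  also have "\<dots> = (\<Sum>i\<le>N. fps_const (row i) * (fps_const (fps_const b) + fps_X) ^ i)"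
    by (simp only: row_def fps_const_sum sum_distrib_right)
  finally have "row i = 0" if "i \<le> N" for i
    using shifted_variable_powers_independent[of row "fps_const b" N i] that by simp
  then have "c (fst (h m)) (snd (h m)) = 0"
    using shifted_variable_powers_independent[of "c (fst (h m))" e N "snd (h m)"] N[OF assms(4)]
    by (simp add: row_def)
  then show ?thesis using assms(4) inj by (simp add: c_def)
qed

text \<open>
  Setting one variable to \<open>1\<close> loses no information about a form, as its exponent is determined
  by the degree and the other two exponents; distinct monomials of \<open>F\<close> therefore become
  distinct monomials in the shifted coordinates.
\<close>

lemma germ_at_eq_0:
  assumes hom: "homogeneous d F" and zero: "germ_at F P = 0"
  shows "F = 0"
proof (rule poly_mapping_eqI)
  fix m
  let ?K = "Poly_Mapping.keys F"
  have deg: "fst m + fst (snd m) + snd (snd m) = d" if "m \<in> ?K" for m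
    using hom that by (auto simp: homogeneous_def)
  have eval: "eval3 F x y z = (\<Sum>m\<in>?K. const2 (Poly_Mapping.lookup F m) * monomial3 x y z m)" for x y z
    by (rule eval3_superset) auto
  have coeff_0: "Poly_Mapping.lookup F m = 0"
    if "m \<in> ?K" and chart: "germ_at F P = eval3 F x y z"
      and monomials: "\<And>m. monomial3 x y z m = (const2 b + var_s) ^ fst (h m) * (const2 e + var_t) ^ snd (h m)"
      and determined: "\<And>m m'. \<lbrakk>h m = h m'; fst m + fst (snd m) + snd (snd m)
          = fst m' + fst (snd m') + snd (snd m')\<rbrakk> \<Longrightarrow> m = m'" for x y z b e h
  proof -
    have "inj_on h ?K" using deg determined by (intro inj_onI) simp
    moreover have "(\<Sum>m\<in>?K. const2 (Poly_Mapping.lookup F m)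
        * (const2 b + var_s) ^ fst (h m) * (const2 e + var_t) ^ snd (h m)) = 0"
      using zero by (simp add: chart eval monomials mult.assoc)
    ultimately show ?thesis by (rule shifted_monomials_independent[OF finite_keys _ _ that(1)])
  qed
  have "Poly_Mapping.lookup F m = 0" if "m \<in> ?K"
  proof (cases P rule: germ_at_as_eval3)
    case 1
    then show ?thesis
      by (intro coeff_0[OF that, where h = "\<lambda>m. (fst (snd m), snd (snd m))"])
        (auto simp: monomial3_def)
  next
    case 2
    then show ?thesis
      by (intro coeff_0[OF that, where h = "\<lambda>m. (fst m, snd (snd m))"])
        (auto simp: monomial3_def)
  next
    case 3
    then show ?thesis
      by (intro coeff_0[OF that, where h = "\<lambda>m. (fst m, fst (snd m))"])
        (auto simp: monomial3_def)
  qed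
  then show "Poly_Mapping.lookup F m = Poly_Mapping.lookup 0 m"
    by (auto simp: in_keys_iff)
qed

section \<open>Finiteness of the set of local branches\<close>

text \<open>
  Membership in the \<open>n\<close>-th power of the maximal ideal of \<open>\<complex>[[s, t]]\<close>, expressed by coefficients.
\<close>

definition vanishing_order_ge :: "nat \<Rightarrow> germ \<Rightarrow> bool" where
  "vanishing_order_ge n f \<longleftrightarrow> (\<forall>i j. i + j < n \<longrightarrow> fps_nth (fps_nth f i) j = 0)"

lemma vanishing_order_ge_mult:
  assumes "vanishing_order_ge m f" "vanishing_order_ge n g"
  shows "vanishing_order_ge (m + n) (f * g)"
  unfolding vanishing_order_ge_def
proof (intro allI impI)
  fix i j :: nat assume ij: "i + j < m + n"
  have "fps_nth (fps_nth f a) b * fps_nth (fps_nth g (i - a)) (j - b) = 0" if "a \<le> i" "b \<le> j" for a b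
  proof -
    have "a + b < m \<or> (i - a) + (j - b) < n" using ij that by linarith
    then show ?thesis using assms by (auto simp: vanishing_order_ge_def)
  qed
  then show "fps_nth (fps_nth (f * g) i) j = 0"
    unfolding fps_mult_nth fps_sum_nth by (intro sum.neutral ballI) simp
qed

text \<open>
  A power series is invertible once its constant term is, and this applies first in \<open>t\<close>
  and then in \<open>s\<close>.
\<close>

lemma vanishing_order_ge_1_nonunit:
  assumes "\<not> q dvd (1 :: germ)"
  shows "vanishing_order_ge 1 q"
proof (rule ccontr)
  assume "\<not> vanishing_order_ge 1 q"
  then have "fps_nth (fps_nth q 0) 0 \<noteq> 0" by (auto simp: vanishing_order_ge_def)
  then have "fps_nth q 0 * inverse (fps_nth q 0) = 1" by (rule inverse_mult_eq_1')
  then have "q * fps_right_inverse q (inverse (fps_nth q 0)) = 1"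
    by (rule fps_right_inverse)
  then show False using assms by (metis dvd_triv_left)
qed

lemma vanishing_order_ge_prod:
  assumes "finite Q" "\<And>q. q \<in> Q \<Longrightarrow> \<not> q dvd (1 :: germ)"
  shows "vanishing_order_ge (card Q) (\<Prod>Q)"
  using assms
proof (induction Q)
  case empty
  then show ?case by (simp add: vanishing_order_ge_def)
next
  case (insert q Q)
  then show ?case
    using vanishing_order_ge_mult[OF vanishing_order_ge_1_nonunit[of q], of "card Q" "\<Prod>Q"] by simp
qed

lemma vanishing_order_finite:
  assumes "f \<noteq> 0"
  obtains n where "\<And>k. vanishing_order_ge k f \<Longrightarrow> k \<le> n"
proof -
  obtain i where "fps_nth f i \<noteq> 0" using assms by (auto simp: fps_eq_iff)
  then obtain j where "fps_nth (fps_nth f i) j \<noteq> 0" by (auto simp: fps_eq_iff)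
  then have "k \<le> i + j" if "vanishing_order_ge k f" for k
    using that by (meson not_le vanishing_order_ge_def)
  then show thesis using that by blast
qed

lemma prime_dvd_prime_imp_dvd:
  fixes q q' :: "'a::idom"
  assumes "prime_elem q" "prime_elem q'" "q dvd q'"
  shows "q' dvd q"
proof -
  obtain c where c: "q' = q * c" using assms(3) by (auto elim: dvdE)
  have "q' dvd q \<or> q' dvd c" using assms(2) c by (metis dvd_refl prime_elem_dvd_multD)
  moreover have False if "q' dvd c"
  proof -
    obtain e where "c = q' * e" using \<open>q' dvd c\<close> by (auto elim: dvdE)
    then have "q' = q * (q' * e)" using c by simp
    then have "q' * 1 = q' * (q * e)" by (simp only: mult_1_right mult.left_commute[of q'])
    moreover have "q' \<noteq> 0" using assms(2) by (simp add: prime_elem_def)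
    ultimately have "1 = q * e" by (simp only: mult_cancel_left simp_thms)
    then have "q dvd 1" by (rule dvdI)
    then show False using assms(1) prime_elem_not_unit by blast
  qed
  ultimately show ?thesis by blast
qed

lemma prod_nonassociated_primes_dvd:
  fixes f :: "'a::idom"
  assumes "finite Q" "\<And>q. q \<in> Q \<Longrightarrow> prime_elem q" "\<And>q. q \<in> Q \<Longrightarrow> q dvd f"
    and "\<And>q q'. \<lbrakk>q \<in> Q; q' \<in> Q; q dvd q'\<rbrakk> \<Longrightarrow> q = q'"
  shows "\<Prod>Q dvd f"
  using assms
proof (induction Q)
  case empty
  then show ?case by simp
next
  case (insert q Q)
  then have "\<Prod>Q dvd f" by simp
  then obtain k where k: "f = \<Prod>Q * k" by (elim dvdE)
  have "\<not> q dvd \<Prod>Q"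
  proof
    assume "q dvd \<Prod>Q"
    have "prime_elem q" using insert.prems by simp
    have "\<exists>q'\<in>Q. q dvd q'"
      using \<open>finite Q\<close> \<open>q dvd \<Prod>Q\<close>
      by (induction Q) (use \<open>prime_elem q\<close> in \<open>auto simp: prime_elem_dvd_mult_iff prime_elem_not_unit\<close>)
    then show False using insert.prems(3) insert.hyps(2) by blast
  qed
  moreover have "q dvd \<Prod>Q * k" "prime_elem q" using insert.prems k by auto
  ultimately have "q dvd k" by (simp add: prime_elem_dvd_mult_iff)
  then show ?case using insert.hyps k by (simp add: mult.commute mult_dvd_mono)
qed

text \<open>
  Generators of distinct branches are pairwise non-associated primes, so the product of any
  finite set of them divides the local equation, and their number is bounded by its order
  of vanishing.
\<close>

lemma finite_local_branches:
  assumes "germ_at F P \<noteq> 0"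
  shows "finite (local_branches F P)"
proof -
  let ?f = "germ_at F P"
  obtain n where n: "\<And>k. vanishing_order_ge k ?f \<Longrightarrow> k \<le> n"
    using vanishing_order_finite[OF assms] by blast
  have "\<exists>q. prime_elem q \<and> q dvd ?f \<and> \<delta> = {h. q dvd h}" if "\<delta> \<in> local_branches F P" for \<delta>
    using that by (auto simp: local_branches_def)
  then obtain gen where gen: "\<And>\<delta>. \<delta> \<in> local_branches F P \<Longrightarrow>
      prime_elem (gen \<delta>) \<and> gen \<delta> dvd ?f \<and> \<delta> = {h. gen \<delta> dvd h}" by metis
  have "card D \<le> n" if D: "D \<subseteq> local_branches F P" "finite D" for D
  proof -
    have eqI: "\<delta> = \<delta>'" if "\<delta> \<in> D" "\<delta>' \<in> D" "gen \<delta> dvd gen \<delta>'" for \<delta> \<delta>'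
    proof -
      have "gen \<delta>' dvd gen \<delta>" using gen D that prime_dvd_prime_imp_dvd by blast
      then have "{h. gen \<delta> dvd h} = {h. gen \<delta>' dvd h}" using that(3) dvd_trans by blast
      then show ?thesis using gen D that by blast
    qed
    then have "inj_on gen D" by (intro inj_onI eqI) auto
    have "\<Prod>(gen ` D) dvd ?f"
      by (rule prod_nonassociated_primes_dvd) (use gen D eqI in auto)
    then obtain k where k: "?f = \<Prod>(gen ` D) * k" by (elim dvdE)
    have "vanishing_order_ge (card (gen ` D)) (\<Prod>(gen ` D))"
      using gen D by (intro vanishing_order_ge_prod) (auto dest: prime_elem_not_unit)
    then have "vanishing_order_ge (card (gen ` D) + 0) ?f"
      unfolding k by (rule vanishing_order_ge_mult) (simp add: vanishing_order_ge_def)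
    then show ?thesis using n card_image[OF \<open>inj_on gen D\<close>] by fastforce
  qed
  then show ?thesis
    by (metis finite_if_finite_subsets_card_bdd)
qed

section \<open>The weak combinatorial type of a reduced curve\<close>

lemma finite_weak_type_of_curve:
  assumes "reduced_curve F" "has_components F r G"
  shows "finite_weak_type (weak_type_of_curve F r G)"
proof
  let ?W = "weak_type_of_curve F r G"
  fix P \<delta> \<delta>'
  obtain d where d: "homogeneous d F" using assms(1) by (auto simp: reduced_curve_def)
  have "F \<noteq> 0"
  proof
    assume "F = 0"
    then have "0 dvd (1 :: poly3)" using assms(1) by (auto simp: reduced_curve_def squarefree_def)
    then show False by simp
  qed
  then show "finite (branches ?W P)"
    using germ_at_eq_0[OF d] finite_local_branches by (auto simp: weak_type_of_curve_def)
  show "mult ?W P \<delta> \<delta>' = mult ?W P \<delta>' \<delta>"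
  proof -
    have "{f + g | f g. f \<in> \<delta> \<and> g \<in> \<delta>'} = {f + g | f g. f \<in> \<delta>' \<and> g \<in> \<delta>}"
      by (auto, (metis add.commute)+)
    then show ?thesis by (simp add: weak_type_of_curve_def intersection_number_def)
  qed
  assume "\<delta> \<in> branches ?W P"
  then obtain q where q: "prime_elem q" "q dvd germ_at F P" "\<delta> = {h. q dvd h}"
    by (auto simp: weak_type_of_curve_def local_branches_def)
  have "q dvd (\<Prod>i\<in>{1..r}. germ_at (G i) P)"
    using q(2) assms(2) by (simp add: has_components_def germ_at_prod)
  moreover have "\<exists>i\<in>A. q dvd germ_at (G i) P" if "finite A" "q dvd (\<Prod>i\<in>A. germ_at (G i) P)" for A
    using that by (induction A) (use q(1) in \<open>auto simp: prime_elem_dvd_mult_iff prime_elem_not_unit\<close>)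
  ultimately have "\<exists>i. i \<in> {1..r} \<and> germ_at (G i) P \<in> \<delta>" unfolding q(3) by blast
  from someI_ex[OF this] show "branch_comp ?W P \<delta> \<in> {1..num_comp ?W}"
    by (simp add: weak_type_of_curve_def branch_component_def)
qed

theorem proposition19:
  fixes F :: poly3 and r :: nat and G :: "nat \<Rightarrow> poly3"
    and \<alpha> :: "nat \<Rightarrow> 'p::prime_card mod_ring"
  assumes "reduced_curve F"
    and "has_components F r G"
    and "\<alpha> \<in> A1 (weak_type_of_curve F r G)"
    and "\<forall>i \<in> {1..r}. \<alpha> i \<noteq> 0"
    and "completely_reductive (weak_type_of_curve F r G) \<alpha>"
  shows "H1 (weak_type_of_curve F r G) \<alpha> = {coboundaries1 \<alpha>}"
proof -
  interpret finite_weak_type "weak_type_of_curve F r G"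
    using assms(1,2) by (rule finite_weak_type_of_curve)
  have "num_comp (weak_type_of_curve F r G) = r" by (simp add: weak_type_of_curve_def)
  then show ?thesis using assms(3-5) by (intro H1_eq_coboundaries1) auto
qed

end
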